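(* Let $v \in \mathbb V$, and assume that the equation $(\mathbf K\circ\mathbf D)(\xi) = v$ has a unique $\|\cdot\|_{1,\mathbf w}$-minimizing solution $\xi^\dagger$. Let $\rho > \|\xi^\dagger\|_{\ell^2(\Lambda)}$, and let $\alpha \colon (0,\infty)\to(0,\infty)$ be such that $$\lim_{\delta\to 0}\alpha(\delta) = \lim_{\delta\to 0} \frac{\Delta_\rho(\alpha(\delta))^2}{\alpha(\delta)} = \lim_{\delta\to 0}\frac{\delta^2}{\alpha(\delta)} = 0 .$$ Let $(\delta_k)_{k\in\mathbb N}\in(0,\infty)^{\mathbb N}$ and $(v_k)_{k\in\mathbb N}\in\mathbb V^{\mathbb N}$ satisfy $\delta_k\to 0$ and $\|v - v_k\|\le\delta_k$. Assume, additionally, that the maps $(\mathbf D_\alpha)_{\alpha>0}$ are uniformly Lipschitz, i.e. Lipschitz continuous with a common Lipschitz constant. Choose $\xi_k\in\arg\min \mathcal S_{\alpha(\delta_k),v_k}$ for each $k$, and define $u^\dagger = \mathbf D(\xi^\dagger)$ and $u_k = \mathbf D_{\alpha(\delta_k)}(\xi_k)$. Then $\lim_{k\to\infty}\|u_k-u^\dagger\| = 0$.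
   Context: Setting and standing assumptions: $\mathbb U$ and $\mathbb V$ are Hilbert spaces; $\mathbf K \colon \mathbb U \to \mathbb V$ is linear and bounded; $\Lambda$ is an at most countable set; $\mathbf D \colon \ell^2(\Lambda)\to\mathbb U$ and $\mathbf D_\alpha \colon \ell^2(\Lambda) \to \mathbb U$ for $\alpha>0$ are given (possibly non-linear) maps; for every $\alpha>0$ the map $\mathbf D_\alpha$ is weakly sequentially continuous; $\mathbf w = (w_\lambda)_{\lambda\in\Lambda} \in (0,\infty)^\Lambda$ satisfies $\inf_{\lambda\in\Lambda} w_\lambda > 0$. Moreover, for every $\rho>0$, $$\Delta_\rho(\alpha) = \sup_{\|\xi\|_{\ell^2(\Lambda)}\le\rho}\|\mathbf D_\alpha(\xi)-\mathbf D(\xi)\|_{\mathbb U} \to 0 \quad\text{as } \alpha\to 0.$$ The weighted $\ell^1$-norm is $\|\xi\|_{1,\mathbf w} = \sum_{\lambda\in\Lambda} w_\lambda |\xi_\lambda| \in [0,\infty]$ for $\xi\in\ell^2(\Lambda)$. For $\alpha>0$ and $v \in \mathbb V$ the deep synthesis functional is $$\mathcal S_{\alpha,v}(\xi) = \|(\mathbf K\circ \mathbf D_\alpha)(\xi) - v\|_{\mathbb V}^2 + \alpha \|\xi\|_{1,\mathbf w},\qquad \xi\in\ell^2(\Lambda).$$ A $\|\cdot\|_{1,\mathbf w}$-minimizing solution of $(\mathbf K\circ\mathbf D)(\xi)=v$ is an element of $\arg\min\{\|\xi\|_{1,\mathbf w} \mid (\mathbf K\circ\mathbf D)(\xi)=v\}$,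 with the convention that the minimal value is finite. *)

theory Defs
  imports "HOL-Analysis.Analysis"
begin

text \<open>
  The elements of \<open>\<ell>\<^sup>2(\<Lambda>)\<close> are the square-summable families on \<open>\<Lambda>\<close>, represented by functions on the
  ambient index type that vanish outside \<open>\<Lambda>\<close>, so that equality of families is equality of functions.
  The coefficients lie in a type \<open>'k\<close> of sort \<open>{real_normed_field, euclidean_space}\<close>, which has both
  the real and the complex numbers as instances. All linear structure is taken over the reals; a
  complex Hilbert space is also a real one with the inner product \<open>Re \<langle>x, y\<rangle>\<close>, and this changes
  neither its norm nor its weak topology.
\<close>

definition ell2 :: "'l set \<Rightarrow> ('l \<Rightarrow> 'k::{real_normed_field, euclidean_space}) set" where
  "ell2 \<Lambda> = {\<xi>. (\<forall>l. l \<notin> \<Lambda> \<longrightarrow> \<xi> l = 0) \<and> (\<lambda>l. (norm (\<xi> l))\<^sup>2) summable_on \<Lambda>}"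

definition ell2_norm :: "'l set \<Rightarrow> ('l \<Rightarrow> 'k::{real_normed_field, euclidean_space}) \<Rightarrow> real" where
  "ell2_norm \<Lambda> \<xi> = sqrt (\<Sum>\<^sub>\<infinity>l\<in>\<Lambda>. (norm (\<xi> l))\<^sup>2)"

definition ell2_bounded_functional ::
    "'l set \<Rightarrow> (('l \<Rightarrow> 'k::{real_normed_field, euclidean_space}) \<Rightarrow> real) \<Rightarrow> bool" where
  "ell2_bounded_functional \<Lambda> F \<longleftrightarrow>
     (\<forall>\<xi>\<in>ell2 \<Lambda>. \<forall>\<eta>\<in>ell2 \<Lambda>. F (\<lambda>l. \<xi> l + \<eta> l) = F \<xi> + F \<eta>) \<and>
     (\<forall>\<xi>\<in>ell2 \<Lambda>. \<forall>c. F (\<lambda>l. c *\<^sub>R \<xi> l) = c * F \<xi>) \<and>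
     (\<exists>C. \<forall>\<xi>\<in>ell2 \<Lambda>. \<bar>F \<xi>\<bar> \<le> C * ell2_norm \<Lambda> \<xi>)"

definition ell2_weak_limit ::
    "'l set \<Rightarrow> (nat \<Rightarrow> 'l \<Rightarrow> 'k::{real_normed_field, euclidean_space}) \<Rightarrow> ('l \<Rightarrow> 'k) \<Rightarrow> bool" where
  "ell2_weak_limit \<Lambda> X \<xi> \<longleftrightarrow>
     (\<forall>n. X n \<in> ell2 \<Lambda>) \<and> \<xi> \<in> ell2 \<Lambda> \<and>
     (\<forall>F. ell2_bounded_functional \<Lambda> F \<longrightarrow> (\<lambda>n. F (X n)) \<longlonglongrightarrow> F \<xi>)"

definition weak_limit :: "(nat \<Rightarrow> 'u::real_normed_vector) \<Rightarrow> 'u \<Rightarrow> bool" where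
  "weak_limit X x \<longleftrightarrow>
     (\<forall>f::'u \<Rightarrow> real. bounded_linear f \<longrightarrow> (\<lambda>n. f (X n)) \<longlonglongrightarrow> f x)"

definition weakly_seq_continuous ::
    "'l set \<Rightarrow> (('l \<Rightarrow> 'k::{real_normed_field, euclidean_space}) \<Rightarrow> 'u::real_normed_vector) \<Rightarrow> bool" where
  "weakly_seq_continuous \<Lambda> G \<longleftrightarrow>
     (\<forall>X \<xi>. ell2_weak_limit \<Lambda> X \<xi> \<longrightarrow> weak_limit (\<lambda>n. G (X n)) (G \<xi>))"

definition weighted_l1_norm ::
    "'l set \<Rightarrow> ('l \<Rightarrow> real) \<Rightarrow> ('l \<Rightarrow> 'k::{real_normed_field, euclidean_space}) \<Rightarrow> ennreal" where
  "weighted_l1_norm \<Lambda> w \<xi> = (\<Sum>\<^sub>\<infinity>l\<in>\<Lambda>. ennreal (w l * norm (\<xi> l)))"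

text \<open>
  The supremum of \<open>\<parallel>D\<^sub>a(\<xi>) - D(\<xi>)\<parallel>\<close> over the ball of radius \<open>\<rho>\<close>. It is taken in \<open>[0,\<infinity>]\<close>, because
  it need not be finite for every parameter \<open>a\<close>.
\<close>

definition approx_error ::
    "'l set \<Rightarrow> (('l \<Rightarrow> 'k::{real_normed_field, euclidean_space}) \<Rightarrow> 'u::real_normed_vector) \<Rightarrow>
     (real \<Rightarrow> ('l \<Rightarrow> 'k) \<Rightarrow> 'u) \<Rightarrow> real \<Rightarrow> real \<Rightarrow> ennreal" where
  "approx_error \<Lambda> D Da \<rho> a =
     (SUP \<xi>\<in>{\<xi> \<in> ell2 \<Lambda>. ell2_norm \<Lambda> \<xi> \<le> \<rho>}. ennreal (norm (Da a \<xi> - D \<xi>)))"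

definition synthesis_functional ::
    "'l set \<Rightarrow> ('l \<Rightarrow> real) \<Rightarrow> ('u \<Rightarrow> 'v::real_normed_vector) \<Rightarrow>
     (real \<Rightarrow> ('l \<Rightarrow> 'k::{real_normed_field, euclidean_space}) \<Rightarrow> 'u) \<Rightarrow>
     real \<Rightarrow> 'v \<Rightarrow> ('l \<Rightarrow> 'k) \<Rightarrow> ennreal" where
  "synthesis_functional \<Lambda> w K Da a v \<xi> =
     ennreal ((norm ((K \<circ> Da a) \<xi> - v))\<^sup>2) + ennreal a * weighted_l1_norm \<Lambda> w \<xi>"

definition l1_minimizing_solution ::
    "'l set \<Rightarrow> ('l \<Rightarrow> real) \<Rightarrow> (('l \<Rightarrow> 'k::{real_normed_field, euclidean_space}) \<Rightarrow> 'v) \<Rightarrow>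
     'v \<Rightarrow> ('l \<Rightarrow> 'k) \<Rightarrow> bool" where
  "l1_minimizing_solution \<Lambda> w A v \<xi> \<longleftrightarrow>
     is_arg_min (weighted_l1_norm \<Lambda> w) (\<lambda>\<eta>. \<eta> \<in> ell2 \<Lambda> \<and> A \<eta> = v) \<xi> \<and>
     weighted_l1_norm \<Lambda> w \<xi> < \<infinity>"

definition uniformly_Lipschitz ::
    "'l set \<Rightarrow> (real \<Rightarrow> ('l \<Rightarrow> 'k::{real_normed_field, euclidean_space}) \<Rightarrow> 'u::real_normed_vector) \<Rightarrow> bool" where
  "uniformly_Lipschitz \<Lambda> Da \<longleftrightarrow>
     (\<exists>L. \<forall>a>0. \<forall>\<xi>\<in>ell2 \<Lambda>. \<forall>\<eta>\<in>ell2 \<Lambda>.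
        norm (Da a \<xi> - Da a \<eta>) \<le> L * ell2_norm \<Lambda> (\<lambda>l. \<xi> l - \<eta> l))"

end

theory Submission
  imports Defs "HOL-Complex_Analysis.Great_Picard"
begin

text \<open>
  Let \<open>a k = \<alpha> (\<delta> k)\<close> and let \<open>C\<close> be the weighted \<open>\<ell>\<^sup>1\<close>-norm of \<open>\<xi>\<^sub>0\<close>. Comparing the functional
  at its minimizer \<open>\<xi> k\<close> with its value at \<open>\<xi>\<^sub>0\<close> bounds the weighted norm of \<open>\<xi> k\<close> by
  \<open>C + (m k)\<^sup>2 / a k\<close> and its squared residual by \<open>(m k)\<^sup>2 + a k * C\<close>
  (\<open>synthesis_minimizer_bounds\<close>), where \<open>m k\<close> is the residual at \<open>\<xi>\<^sub>0\<close>. The parameter choice gives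
  \<open>(m k)\<^sup>2 / a k \<longlonglongrightarrow> 0\<close> (\<open>discrepancy_quotient_tendsto_0\<close>).

  Since the weights are bounded below, the \<open>\<xi> k\<close> are bounded in \<open>\<ell>\<^sup>2\<close>, so every subsequence has a
  further one that converges coordinatewise, hence weakly (\<open>ell2_weak_limitI\<close>), to some \<open>\<eta>\<close>. On balls
  \<open>D\<close> is a uniform limit of weakly sequentially continuous maps, so it preserves weak limits of
  bounded sequences (\<open>weak_limit_uniform_approx\<close>), and \<open>\<eta>\<close> solves \<open>K (D \<eta>) = v\<close>. By lower
  semicontinuity \<open>\<eta>\<close> has weighted norm at most \<open>C\<close>, so uniqueness yields \<open>\<eta> = \<xi>\<^sub>0\<close>. Coordinatewise
  convergence without loss of mass is convergence in the weighted norm (\<open>weighted_l1_norm_diff_le\<close>),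
  and a fortiori in \<open>\<ell>\<^sup>2\<close>. Thus the whole sequence \<open>\<xi> k\<close> converges to \<open>\<xi>\<^sub>0\<close> in \<open>\<ell>\<^sup>2\<close>; the common
  Lipschitz constant and the convergence of \<open>Da (a k) \<xi>\<^sub>0\<close> to \<open>D \<xi>\<^sub>0\<close> finish the proof.
\<close>

section \<open>Norm bounds through finite partial sums\<close>

lemma ell2_norm_le_iff:
  assumes "r \<ge> 0" and "\<And>l. l \<notin> \<Lambda> \<Longrightarrow> x l = 0"
  shows "x \<in> ell2 \<Lambda> \<and> ell2_norm \<Lambda> x \<le> r \<longleftrightarrow>
         (\<forall>S. finite S \<and> S \<subseteq> \<Lambda> \<longrightarrow> (\<Sum>l\<in>S. (norm (x l))\<^sup>2) \<le> r\<^sup>2)" (is "?L \<longleftrightarrow> ?R")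
proof
  assume ?L
  then have summ: "(\<lambda>l. (norm (x l))\<^sup>2) summable_on \<Lambda>" and le: "ell2_norm \<Lambda> x \<le> r"
    by (auto simp: ell2_def)
  have "(\<Sum>\<^sub>\<infinity>l\<in>\<Lambda>. (norm (x l))\<^sup>2) \<le> r\<^sup>2"
    using le unfolding ell2_norm_def by (simp add: sqrt_le_D)
  moreover have "(\<Sum>l\<in>S. (norm (x l))\<^sup>2) \<le> (\<Sum>\<^sub>\<infinity>l\<in>\<Lambda>. (norm (x l))\<^sup>2)"
    if "finite S" "S \<subseteq> \<Lambda>" for S
    using that by (intro finite_sum_le_infsum[OF summ]) auto
  ultimately show ?R by force
next
  assume R: ?R
  have summ: "(\<lambda>l. (norm (x l))\<^sup>2) summable_on \<Lambda>"
    by (rule nonneg_bdd_above_summable_on) (use R in \<open>auto intro!: bdd_aboveI[of _ "r\<^sup>2"]\<close>)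
  moreover have "(\<Sum>\<^sub>\<infinity>l\<in>\<Lambda>. (norm (x l))\<^sup>2) \<le> r\<^sup>2"
    using R by (intro infsum_le_finite_sums[OF summ]) auto
  ultimately show ?L
    using assms by (auto simp: ell2_def ell2_norm_def real_le_lsqrt infsum_nonneg)
qed

lemma ell2_norm_nonneg: "ell2_norm \<Lambda> x \<ge> 0"
  by (simp add: ell2_norm_def infsum_nonneg)

lemma ell2_eq_0: "x \<in> ell2 \<Lambda> \<Longrightarrow> l \<notin> \<Lambda> \<Longrightarrow> x l = 0"
  by (simp add: ell2_def)

lemma ell2_sum_le:
  assumes "x \<in> ell2 \<Lambda>" "ell2_norm \<Lambda> x \<le> r" "finite S" "S \<subseteq> \<Lambda>"
  shows "(\<Sum>l\<in>S. (norm (x l))\<^sup>2) \<le> r\<^sup>2"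
proof -
  have "r \<ge> 0" using assms(2) ell2_norm_nonneg order_trans by blast
  from ell2_norm_le_iff[of r \<Lambda> x, OF this] ell2_eq_0[OF assms(1)] assms show ?thesis by simp
qed

lemma ell2_norm_leI:
  assumes "r \<ge> 0" "\<And>l. l \<notin> \<Lambda> \<Longrightarrow> x l = 0"
    and "\<And>S. finite S \<Longrightarrow> S \<subseteq> \<Lambda> \<Longrightarrow> (\<Sum>l\<in>S. (norm (x l))\<^sup>2) \<le> r\<^sup>2"
  shows "x \<in> ell2 \<Lambda>" "ell2_norm \<Lambda> x \<le> r"
  using ell2_norm_le_iff[of r \<Lambda> x, OF assms(1,2)] assms(3) by simp_all

lemma ell2_norm_finite_support:
  assumes "finite S" "S \<subseteq> \<Lambda>" "\<And>l. l \<notin> S \<Longrightarrow> x l = 0"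
  shows "x \<in> ell2 \<Lambda>" "ell2_norm \<Lambda> x = sqrt (\<Sum>l\<in>S. (norm (x l))\<^sup>2)"
proof -
  have "(\<lambda>l. (norm (x l))\<^sup>2) summable_on \<Lambda> \<longleftrightarrow> (\<lambda>l. (norm (x l))\<^sup>2) summable_on S"
    by (rule summable_on_cong_neutral) (use assms in auto)
  then show "x \<in> ell2 \<Lambda>"
    using assms by (auto simp: ell2_def)
  have "(\<Sum>\<^sub>\<infinity>l\<in>\<Lambda>. (norm (x l))\<^sup>2) = (\<Sum>\<^sub>\<infinity>l\<in>S. (norm (x l))\<^sup>2)"
    by (rule infsum_cong_neutral) (use assms in auto)
  then show "ell2_norm \<Lambda> x = sqrt (\<Sum>l\<in>S. (norm (x l))\<^sup>2)"
    using assms by (simp add: ell2_norm_def)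
qed

lemma ell2_scaleR:
  assumes "x \<in> ell2 \<Lambda>"
  shows "(\<lambda>l. c *\<^sub>R x l) \<in> ell2 \<Lambda>" "ell2_norm \<Lambda> (\<lambda>l. c *\<^sub>R x l) = \<bar>c\<bar> * ell2_norm \<Lambda> x"
  using assms
  by (auto simp: ell2_def ell2_norm_def power_mult_distrib infsum_cmult_right' real_sqrt_mult
      intro!: summable_on_cmult_right)

lemma ell2_add_disjoint:
  assumes "x \<in> ell2 \<Lambda>" "y \<in> ell2 \<Lambda>" "\<And>l. x l = 0 \<or> y l = 0"
  shows "(\<lambda>l. x l + y l) \<in> ell2 \<Lambda>"
    "(ell2_norm \<Lambda> (\<lambda>l. x l + y l))\<^sup>2 = (ell2_norm \<Lambda> x)\<^sup>2 + (ell2_norm \<Lambda> y)\<^sup>2"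
proof -
  have eq: "(norm (x l + y l))\<^sup>2 = (norm (x l))\<^sup>2 + (norm (y l))\<^sup>2" for l
    using assms(3)[of l] by auto
  show "(\<lambda>l. x l + y l) \<in> ell2 \<Lambda>"
    using assms(1,2) by (auto simp: ell2_def eq intro: summable_on_add)
  show "(ell2_norm \<Lambda> (\<lambda>l. x l + y l))\<^sup>2 = (ell2_norm \<Lambda> x)\<^sup>2 + (ell2_norm \<Lambda> y)\<^sup>2"
    using assms(1,2) by (simp add: ell2_def ell2_norm_def eq infsum_add infsum_nonneg)
qed

text \<open>The crude constant avoids Minkowski's inequality; only boundedness is needed later.\<close>

lemma ell2_diff:
  assumes "x \<in> ell2 \<Lambda>" "ell2_norm \<Lambda> x \<le> r" "y \<in> ell2 \<Lambda>" "ell2_norm \<Lambda> y \<le> s"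
  shows "(\<lambda>l. x l - y l) \<in> ell2 \<Lambda>" "ell2_norm \<Lambda> (\<lambda>l. x l - y l) \<le> sqrt (2 * r\<^sup>2 + 2 * s\<^sup>2)"
proof -
  have "(\<Sum>l\<in>S. (norm (x l - y l))\<^sup>2) \<le> (sqrt (2 * r\<^sup>2 + 2 * s\<^sup>2))\<^sup>2"
    if S: "finite S" "S \<subseteq> \<Lambda>" for S
  proof -
    have "(norm (x l - y l))\<^sup>2 \<le> 2 * (norm (x l))\<^sup>2 + 2 * (norm (y l))\<^sup>2" for l
    proof -
      have "(norm (x l - y l))\<^sup>2 \<le> (norm (x l) + norm (y l))\<^sup>2"
        by (intro power_mono norm_triangle_ineq4) auto
      also have "\<dots> \<le> 2 * (norm (x l))\<^sup>2 + 2 * (norm (y l))\<^sup>2"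
        using sum_squares_bound[of "norm (x l)" "norm (y l)"] by (simp add: power2_sum)
      finally show ?thesis .
    qed
    then have "(\<Sum>l\<in>S. (norm (x l - y l))\<^sup>2) \<le> 2 * (\<Sum>l\<in>S. (norm (x l))\<^sup>2) + 2 * (\<Sum>l\<in>S. (norm (y l))\<^sup>2)"
      by (simp add: sum_distrib_left sum_mono flip: sum.distrib)
    also have "\<dots> \<le> 2 * r\<^sup>2 + 2 * s\<^sup>2"
      using ell2_sum_le[OF assms(1,2) S] ell2_sum_le[OF assms(3,4) S] by simp
    finally show ?thesis by simp
  qed
  from ell2_norm_leI[OF _ _ this]
  show "(\<lambda>l. x l - y l) \<in> ell2 \<Lambda>" "ell2_norm \<Lambda> (\<lambda>l. x l - y l) \<le> sqrt (2 * r\<^sup>2 + 2 * s\<^sup>2)"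
    using ell2_eq_0[OF assms(1)] ell2_eq_0[OF assms(3)] by simp_all
qed

lemma ell2_restrict:
  assumes "x \<in> ell2 \<Lambda>"
  shows "(\<lambda>l. if P l then x l else 0) \<in> ell2 \<Lambda>"
    "ell2_norm \<Lambda> (\<lambda>l. if P l then x l else 0) \<le> ell2_norm \<Lambda> x"
proof -
  have "(\<Sum>l\<in>S. (norm (if P l then x l else 0))\<^sup>2) \<le> (ell2_norm \<Lambda> x)\<^sup>2"
    if S: "finite S" "S \<subseteq> \<Lambda>" for S
  proof -
    have "(\<Sum>l\<in>S. (norm (if P l then x l else 0))\<^sup>2) \<le> (\<Sum>l\<in>S. (norm (x l))\<^sup>2)"
      by (intro sum_mono) auto
    also have "\<dots> \<le> (ell2_norm \<Lambda> x)\<^sup>2"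
      by (rule ell2_sum_le[OF assms order_refl S])
    finally show ?thesis .
  qed
  from ell2_norm_leI[OF ell2_norm_nonneg _ this]
  show "(\<lambda>l. if P l then x l else 0) \<in> ell2 \<Lambda>"
    "ell2_norm \<Lambda> (\<lambda>l. if P l then x l else 0) \<le> ell2_norm \<Lambda> x"
    using ell2_eq_0[OF assms] by simp_all
qed

lemma ell2_remove:
  assumes "x \<in> ell2 \<Lambda>"
  shows "(\<lambda>l. if P l then 0 else x l) \<in> ell2 \<Lambda>"
    "ell2_norm \<Lambda> (\<lambda>l. if P l then 0 else x l) \<le> ell2_norm \<Lambda> x"
proof -
  have "(\<lambda>l. if P l then 0 else x l) = (\<lambda>l. if \<not> P l then x l else 0)" by auto
  then show "(\<lambda>l. if P l then 0 else x l) \<in> ell2 \<Lambda>"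
    "ell2_norm \<Lambda> (\<lambda>l. if P l then 0 else x l) \<le> ell2_norm \<Lambda> x"
    using ell2_restrict[OF assms, of "\<lambda>l. \<not> P l"] by simp_all
qed

lemma ell2_tail_small:
  assumes "x \<in> ell2 \<Lambda>" "e > 0"
  obtains S where "finite S" "S \<subseteq> \<Lambda>" "ell2_norm \<Lambda> (\<lambda>l. if l \<in> S then 0 else x l) \<le> e"
proof -
  have summ: "(\<lambda>l. (norm (x l))\<^sup>2) summable_on \<Lambda>"
    using assms by (simp add: ell2_def)
  obtain S where S: "finite S" "S \<subseteq> \<Lambda>"
    and close: "dist (\<Sum>l\<in>S. (norm (x l))\<^sup>2) (\<Sum>\<^sub>\<infinity>l\<in>\<Lambda>. (norm (x l))\<^sup>2) \<le> e\<^sup>2"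
    using infsum_finite_approximation[OF summ, of "e\<^sup>2"] assms(2) by auto
  have "(\<Sum>l\<in>T. (norm (if l \<in> S then 0 else x l))\<^sup>2) \<le> e\<^sup>2" if T: "finite T" "T \<subseteq> \<Lambda>" for T
  proof -
    have "(\<Sum>l\<in>T. (norm (if l \<in> S then 0 else x l))\<^sup>2) = (\<Sum>l\<in>T - S. (norm (x l))\<^sup>2)"
      by (rule sum.mono_neutral_cong_right) (use T in auto)
    also have "\<dots> = (\<Sum>l\<in>S \<union> T. (norm (x l))\<^sup>2) - (\<Sum>l\<in>S. (norm (x l))\<^sup>2)"
      using S T sum.union_disjoint[of S "T - S" "\<lambda>l. (norm (x l))\<^sup>2"] by auto
    also have "\<dots> \<le> e\<^sup>2"
      using close finite_sum_le_infsum[OF summ, of "S \<union> T"] S T by (auto simp: dist_real_def)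
    finally show ?thesis .
  qed
  from ell2_norm_leI(2)[OF _ _ this] have "ell2_norm \<Lambda> (\<lambda>l. if l \<in> S then 0 else x l) \<le> e"
    using assms ell2_eq_0[OF assms(1)] by simp
  with S that show thesis by blast
qed

lemma weighted_l1_norm_le_iff:
  assumes "C \<ge> 0" "\<And>l. l \<in> \<Lambda> \<Longrightarrow> w l > 0"
  shows "weighted_l1_norm \<Lambda> w x \<le> ennreal C \<longleftrightarrow>
         (\<forall>S. finite S \<and> S \<subseteq> \<Lambda> \<longrightarrow> (\<Sum>l\<in>S. w l * norm (x l)) \<le> C)"
proof -
  have "(\<Sum>l\<in>S. ennreal (w l * norm (x l))) = ennreal (\<Sum>l\<in>S. w l * norm (x l))"
    if "S \<subseteq> \<Lambda>" for S
    using that assms(2) by (intro sum_ennreal) (auto simp: less_imp_le subset_iff)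
  then show ?thesis
    using assms(1)
    by (auto simp: weighted_l1_norm_def nonneg_infsum_complete SUP_le_iff ennreal_le_iff)
qed

lemma ell2_norm_le_weighted_l1_norm:
  assumes "w0 > 0" "\<And>l. l \<in> \<Lambda> \<Longrightarrow> w l \<ge> w0" "C \<ge> 0" "\<And>l. l \<notin> \<Lambda> \<Longrightarrow> x l = 0"
    and "weighted_l1_norm \<Lambda> w x \<le> ennreal C"
  shows "x \<in> ell2 \<Lambda>" "ell2_norm \<Lambda> x \<le> C / w0"
proof -
  have pos: "w l > 0" if "l \<in> \<Lambda>" for l
    using assms(1,2) that by force
  have "(\<Sum>l\<in>S. (norm (x l))\<^sup>2) \<le> (C / w0)\<^sup>2" if S: "finite S" "S \<subseteq> \<Lambda>" for S
  proof -
    have "w0 * (\<Sum>l\<in>S. norm (x l)) \<le> (\<Sum>l\<in>S. w l * norm (x l))"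
      unfolding sum_distrib_left using S assms(2) by (intro sum_mono mult_right_mono) auto
    also have "\<dots> \<le> C"
      using weighted_l1_norm_le_iff[of C \<Lambda> w x] assms(3,5) S pos by simp
    finally have "(\<Sum>l\<in>S. norm (x l)) \<le> C / w0"
      using assms(1) by (simp add: field_simps)
    then have "(\<Sum>l\<in>S. norm (x l))\<^sup>2 \<le> (C / w0)\<^sup>2"
      by (intro power_mono) (auto simp: sum_nonneg)
    moreover have "(\<Sum>l\<in>S. (norm (x l))\<^sup>2) \<le> (\<Sum>l\<in>S. norm (x l))\<^sup>2"
      using S(1)
    proof (induction S rule: finite_induct)
      case (insert l S)
      then have "0 \<le> norm (x l) * (\<Sum>l\<in>S. norm (x l))" by (simp add: sum_nonneg)
      with insert show ?case by (simp add: power2_sum)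
    qed simp
    ultimately show ?thesis by simp
  qed
  from ell2_norm_leI[OF _ _ this] show "x \<in> ell2 \<Lambda>" "ell2_norm \<Lambda> x \<le> C / w0"
    using assms by simp_all
qed

section \<open>Weak convergence of bounded sequences in \<open>\<ell>\<^sup>2\<close>\<close>

text \<open>
  A replacement for the square summability of the Riesz representative of \<open>F\<close>. If \<open>x\<close> is finitely
  supported, of norm at most 1 and almost maximizes \<open>F\<close> on the unit ball, and if \<open>z\<close> has norm at
  most 1 and disjoint support, then \<open>F x + t * F z \<le> M * sqrt (1 + t\<^sup>2)\<close>, where \<open>M\<close> is the supremum of
  \<open>F\<close> on the ball. The right-hand side exceeds \<open>M\<close> by only \<open>O(t\<^sup>2)\<close>, hence \<open>F z\<close> is of order \<open>t\<close>.
\<close>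

lemma ell2_bounded_functional_tail:
  fixes F :: "('l \<Rightarrow> 'k::{real_normed_field, euclidean_space}) \<Rightarrow> real"
  assumes F: "ell2_bounded_functional \<Lambda> F" and "e > 0"
  obtains S where "finite S" "S \<subseteq> \<Lambda>"
    "\<And>z. z \<in> ell2 \<Lambda> \<Longrightarrow> (\<And>l. l \<in> S \<Longrightarrow> z l = 0) \<Longrightarrow> ell2_norm \<Lambda> z \<le> 1 \<Longrightarrow> \<bar>F z\<bar> \<le> e"
proof -
  have add: "\<And>x y. x \<in> ell2 \<Lambda> \<Longrightarrow> y \<in> ell2 \<Lambda> \<Longrightarrow> F (\<lambda>l. x l + y l) = F x + F y"
    and scale: "\<And>x c. x \<in> ell2 \<Lambda> \<Longrightarrow> F (\<lambda>l. c *\<^sub>R x l) = c * F x"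
    using F by (auto simp: ell2_bounded_functional_def)
  obtain C where C: "\<And>x. x \<in> ell2 \<Lambda> \<Longrightarrow> \<bar>F x\<bar> \<le> C * ell2_norm \<Lambda> x"
    using F unfolding ell2_bounded_functional_def by blast
  define B :: "('l \<Rightarrow> 'k) set" where "B = {x \<in> ell2 \<Lambda>. ell2_norm \<Lambda> x \<le> 1}"
  define M where "M = Sup (F ` B)"
  have zero: "(\<lambda>l. 0) \<in> B" "F (\<lambda>l. 0) = 0"
  proof -
    have "(\<lambda>l::'l. 0::'k) \<in> ell2 \<Lambda>" "ell2_norm \<Lambda> (\<lambda>l::'l. 0::'k) = 0"
      by (auto simp: ell2_def ell2_norm_def)
    with C[of "\<lambda>l. 0"] show "(\<lambda>l. 0) \<in> B" "F (\<lambda>l. 0) = 0"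
      by (auto simp: B_def)
  qed
  have "F x \<le> \<bar>C\<bar>" if "x \<in> B" for x
  proof -
    have "F x \<le> C * ell2_norm \<Lambda> x"
      using that C[of x] by (simp add: B_def)
    also have "\<dots> \<le> \<bar>C\<bar> * 1"
      using that ell2_norm_nonneg[of \<Lambda> x] by (intro mult_mono) (auto simp: B_def)
    finally show ?thesis by simp
  qed
  then have bdd: "bdd_above (F ` B)" by (intro bdd_aboveI2)
  then have "0 \<le> M"
    using cSup_upper[of "F (\<lambda>l. 0)" "F ` B"] zero by (auto simp: M_def)
  have FM: "F x \<le> M * s" if x: "x \<in> ell2 \<Lambda>" "ell2_norm \<Lambda> x \<le> s" "s > 0" for x s
  proof -
    have "(\<lambda>l. (1 / s) *\<^sub>R x l) \<in> B"
      using x ell2_scaleR[OF x(1), of "1 / s"] by (simp add: B_def)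
    then have "F (\<lambda>l. (1 / s) *\<^sub>R x l) \<le> M"
      unfolding M_def using bdd by (intro cSup_upper) auto
    then show ?thesis
      using scale[OF x(1), of "1 / s"] x(3) by (simp add: field_simps)
  qed
  \<comment> \<open>the argument below gives \<open>F z \<le> t * (1 + 3 / 2 * M)\<close>, which must not exceed \<open>e\<close>\<close>
  define t where "t = e / (2 + 2 * M)"
  have t: "t > 0" "t * (1 + 3 / 2 * M) \<le> e"
  proof -
    show "t > 0" using \<open>e > 0\<close> \<open>0 \<le> M\<close> by (simp add: t_def)
    then have "t * (1 + 3 / 2 * M) \<le> t * (2 + 2 * M)"
      using \<open>0 \<le> M\<close> by (intro mult_left_mono) auto
    also have "\<dots> = e" using \<open>0 \<le> M\<close> by (simp add: t_def)
    finally show "t * (1 + 3 / 2 * M) \<le> e" .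
  qed
  have "M - t\<^sup>2 < Sup (F ` B)" using t by (simp add: M_def)
  then obtain x where x: "x \<in> B" "F x > M - t\<^sup>2"
    using less_cSupE[of "M - t\<^sup>2" "F ` B"] zero by blast
  then have xl: "x \<in> ell2 \<Lambda>" "ell2_norm \<Lambda> x \<le> 1" by (auto simp: B_def)
  obtain S where S: "finite S" "S \<subseteq> \<Lambda>" "ell2_norm \<Lambda> (\<lambda>l. if l \<in> S then 0 else x l) \<le> t\<^sup>2"
    using ell2_tail_small[OF xl(1), of "t\<^sup>2"] t by auto
  \<comment> \<open>passing to the finitely supported part \<open>x'\<close> of \<open>x\<close> costs only \<open>M * t\<^sup>2\<close>\<close>
  define x' where "x' = (\<lambda>l. if l \<in> S then x l else 0)"
  define x'' where "x'' = (\<lambda>l. if l \<in> S then 0 else x l)"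
  have x': "x' \<in> ell2 \<Lambda>" "ell2_norm \<Lambda> x' \<le> 1"
    using ell2_restrict[OF xl(1), of "\<lambda>l. l \<in> S"] xl(2) by (simp_all add: x'_def)
  have x'': "x'' \<in> ell2 \<Lambda>"
    unfolding x''_def by (rule ell2_remove(1)[OF xl(1)])
  have "F x = F x' + F x''"
  proof -
    have "(\<lambda>l. x' l + x'' l) = x" by (auto simp: x'_def x''_def)
    then show ?thesis using add[OF x'(1) x''] by simp
  qed
  moreover have "F x'' \<le> M * t\<^sup>2"
    using FM[OF x'', of "t\<^sup>2"] S(3) t by (simp add: x''_def)
  ultimately have Fx': "F x' \<ge> M - t\<^sup>2 - M * t\<^sup>2"
    using x(2) by simp
  have upper: "F z \<le> e" if z: "z \<in> ell2 \<Lambda>" "\<And>l. l \<in> S \<Longrightarrow> z l = 0" "ell2_norm \<Lambda> z \<le> 1" for z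
  proof -
    define y where "y = (\<lambda>l. t *\<^sub>R z l)"
    have y: "y \<in> ell2 \<Lambda>" "ell2_norm \<Lambda> y \<le> t"
      using ell2_scaleR[OF z(1), of t] z(3) t(1) by (auto simp: y_def)
    have disj: "x' l = 0 \<or> y l = 0" for l
      using z(2) by (simp add: x'_def y_def)
    have "(ell2_norm \<Lambda> (\<lambda>l. x' l + y l))\<^sup>2 \<le> 1\<^sup>2 + t\<^sup>2"
      unfolding ell2_add_disjoint(2)[OF x'(1) y(1) disj]
      using x' y ell2_norm_nonneg by (intro add_mono power_mono) auto
    also have "\<dots> \<le> (1 + t\<^sup>2 / 2)\<^sup>2"
      by (simp add: power2_sum)
    finally have "ell2_norm \<Lambda> (\<lambda>l. x' l + y l) \<le> 1 + t\<^sup>2 / 2"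
      by (rule power2_le_imp_le) simp
    then have "F (\<lambda>l. x' l + y l) \<le> M * (1 + t\<^sup>2 / 2)"
      by (intro FM ell2_add_disjoint x' y disj) (auto intro: add_pos_nonneg)
    then have "F x' + t * F z \<le> M * (1 + t\<^sup>2 / 2)"
      using add[OF x'(1) y(1)] scale[OF z(1), of t] by (simp add: y_def)
    with Fx' have "t * F z \<le> t * (t * (1 + 3 / 2 * M))"
      by (simp add: power2_eq_square algebra_simps)
    with t show ?thesis by simp
  qed
  have "\<bar>F z\<bar> \<le> e" if z: "z \<in> ell2 \<Lambda>" "\<And>l. l \<in> S \<Longrightarrow> z l = 0" "ell2_norm \<Lambda> z \<le> 1" for z
    using upper[OF z] upper[of "\<lambda>l. (-1) *\<^sub>R z l"] z ell2_scaleR[OF z(1), of "-1"] scale[OF z(1), of "-1"]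
    by auto
  with S that show thesis by blast
qed

lemma ell2_weak_limitI:
  fixes X :: "nat \<Rightarrow> 'l \<Rightarrow> 'k::{real_normed_field, euclidean_space}"
  assumes X: "\<And>n. X n \<in> ell2 \<Lambda>" "\<And>n. ell2_norm \<Lambda> (X n) \<le> r" and x: "x \<in> ell2 \<Lambda>"
    and coord: "\<And>l. l \<in> \<Lambda> \<Longrightarrow> (\<lambda>n. X n l) \<longlonglongrightarrow> x l"
  shows "ell2_weak_limit \<Lambda> X x"
  unfolding ell2_weak_limit_def
proof (intro conjI allI impI X(1) x)
  fix F :: "('l \<Rightarrow> 'k) \<Rightarrow> real" assume F: "ell2_bounded_functional \<Lambda> F"
  then have add: "\<And>x y. x \<in> ell2 \<Lambda> \<Longrightarrow> y \<in> ell2 \<Lambda> \<Longrightarrow> F (\<lambda>l. x l + y l) = F x + F y"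
    and scale: "\<And>x c. x \<in> ell2 \<Lambda> \<Longrightarrow> F (\<lambda>l. c *\<^sub>R x l) = c * F x"
    by (auto simp: ell2_bounded_functional_def)
  obtain C where C: "\<And>x. x \<in> ell2 \<Lambda> \<Longrightarrow> \<bar>F x\<bar> \<le> C * ell2_norm \<Lambda> x"
    using F unfolding ell2_bounded_functional_def by blast
  define y where "y = (\<lambda>n l. X n l - x l)"
  define R where "R = 1 + sqrt (2 * r\<^sup>2 + 2 * (ell2_norm \<Lambda> x)\<^sup>2)"
  have "R > 0" by (simp add: R_def add_pos_nonneg)
  have y: "y n \<in> ell2 \<Lambda>" "ell2_norm \<Lambda> (y n) \<le> R" for n
    using ell2_diff[OF X x order_refl, of n] by (auto simp: y_def R_def)
  have FX: "F (X n) = F x + F (y n)" for n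
    using add[OF x y(1), of n] by (simp add: y_def)
  have "(F \<circ> y) \<longlonglongrightarrow> 0"
  proof (rule LIMSEQ_I)
    fix e :: real assume "e > 0"
    then obtain S where S: "finite S" "S \<subseteq> \<Lambda>"
      and tail: "\<And>z. z \<in> ell2 \<Lambda> \<Longrightarrow> (\<And>l. l \<in> S \<Longrightarrow> z l = 0) \<Longrightarrow> ell2_norm \<Lambda> z \<le> 1 \<Longrightarrow> \<bar>F z\<bar> \<le> e / (2 * R)"
      using ell2_bounded_functional_tail[OF F, of "e / (2 * R)"] \<open>R > 0\<close> by auto
    define u where "u = (\<lambda>n l. if l \<in> S then y n l else 0)"
    define z where "z = (\<lambda>n l. if l \<in> S then 0 else y n l)"
    have u: "u n \<in> ell2 \<Lambda>" "ell2_norm \<Lambda> (u n) = sqrt (\<Sum>l\<in>S. (norm (u n l))\<^sup>2)" for n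
      using ell2_norm_finite_support[OF S, of "u n"] by (auto simp: u_def)
    have z: "z n \<in> ell2 \<Lambda>" "ell2_norm \<Lambda> (z n) \<le> R" for n
      using ell2_remove[OF y(1)[of n], of "\<lambda>l. l \<in> S"] y(2)[of n] by (simp_all add: z_def)
    have "\<bar>F (\<lambda>l. (1 / R) *\<^sub>R z n l)\<bar> \<le> e / (2 * R)" for n
      using ell2_scaleR[OF z(1), of "1 / R" n] z(2)[of n] \<open>R > 0\<close>
      by (intro tail) (auto simp: z_def)
    then have Fz: "\<bar>F (z n)\<bar> \<le> e / 2" for n
      unfolding scale[OF z(1)] abs_mult using \<open>R > 0\<close> by (simp add: field_simps)
    have "(\<lambda>n. u n l) \<longlonglongrightarrow> 0" if "l \<in> S" for l
      using coord[of l] that S(2) by (auto simp: u_def y_def LIM_zero_iff)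
    then have "(\<lambda>n. C * sqrt (\<Sum>l\<in>S. (norm (u n l))\<^sup>2)) \<longlonglongrightarrow> C * sqrt (\<Sum>l\<in>S. (norm (0::'k))\<^sup>2)"
      by (intro tendsto_intros)
    then have "(\<lambda>n. C * ell2_norm \<Lambda> (u n)) \<longlonglongrightarrow> 0"
      by (simp add: u)
    then have "\<forall>\<^sub>F n in sequentially. C * ell2_norm \<Lambda> (u n) < e / 2"
      using \<open>e > 0\<close> by (intro order_tendstoD) auto
    then have "\<forall>\<^sub>F n in sequentially. norm ((F \<circ> y) n - 0) < e"
    proof eventually_elim
      case (elim n)
      have "(\<lambda>l. u n l + z n l) = y n" by (auto simp: u_def z_def)
      then have "F (y n) = F (u n) + F (z n)"
        using add[OF u(1) z(1), of n n] by simp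
      with elim Fz[of n] C[OF u(1), of n] show ?case by simp
    qed
    then show "\<exists>N. \<forall>n\<ge>N. norm ((F \<circ> y) n - 0) < e"
      by (simp add: eventually_sequentially)
  qed
  from tendsto_add[OF tendsto_const this, of "F x"] show "(\<lambda>n. F (X n)) \<longlonglongrightarrow> F x"
    by (simp add: FX)
qed

section \<open>Convergence in the weighted \<open>\<ell>\<^sup>1\<close>-norm\<close>

lemma weighted_l1_norm_lower_semicontinuous:
  fixes X :: "nat \<Rightarrow> 'l \<Rightarrow> 'k::{real_normed_field, euclidean_space}"
  assumes w: "\<And>l. l \<in> \<Lambda> \<Longrightarrow> w l > 0"
    and coord: "\<And>l. l \<in> \<Lambda> \<Longrightarrow> (\<lambda>n. X n l) \<longlonglongrightarrow> x l"
    and c: "\<And>n. c n \<ge> 0" "\<And>n. weighted_l1_norm \<Lambda> w (X n) \<le> ennreal (c n)" "c \<longlonglongrightarrow> C"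
  shows "weighted_l1_norm \<Lambda> w x \<le> ennreal C"
proof -
  have "C \<ge> 0"
    using c(1,3) by (intro LIMSEQ_le_const) auto
  moreover have "(\<Sum>l\<in>S. w l * norm (x l)) \<le> C" if S: "finite S" "S \<subseteq> \<Lambda>" for S
  proof (rule LIMSEQ_le)
    show "(\<lambda>n. \<Sum>l\<in>S. w l * norm (X n l)) \<longlonglongrightarrow> (\<Sum>l\<in>S. w l * norm (x l))"
      using coord S by (intro tendsto_intros) auto
    show "\<exists>N. \<forall>n\<ge>N. (\<Sum>l\<in>S. w l * norm (X n l)) \<le> c n"
      using weighted_l1_norm_le_iff[of "c n" \<Lambda> w "X n" for n, OF c(1) w] c(2) S by simp
  qed (fact c(3))
  ultimately show ?thesis
    by (subst weighted_l1_norm_le_iff[OF _ w]) auto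
qed

text \<open>
  A Scheffe-type argument: outside a finite set that carries almost all of the norm of \<open>x\<close>, the
  partial sums of \<open>X n\<close> are small too, because the full norms of \<open>X n\<close> do not exceed that of \<open>x\<close> in
  the limit.
\<close>

lemma weighted_l1_norm_diff_le:
  fixes X :: "nat \<Rightarrow> 'l \<Rightarrow> 'k::{real_normed_field, euclidean_space}"
  assumes w: "\<And>l. l \<in> \<Lambda> \<Longrightarrow> w l > 0"
    and coord: "\<And>l. l \<in> \<Lambda> \<Longrightarrow> (\<lambda>n. X n l) \<longlonglongrightarrow> x l"
    and c: "\<And>n. c n \<ge> 0" "\<And>n. weighted_l1_norm \<Lambda> w (X n) \<le> ennreal (c n)" "c \<longlonglongrightarrow> C"
    and C: "C \<ge> 0" "weighted_l1_norm \<Lambda> w x = ennreal C" and "e > 0"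
  shows "\<forall>\<^sub>F n in sequentially. weighted_l1_norm \<Lambda> w (\<lambda>l. X n l - x l) \<le> ennreal e"
proof -
  have le_x: "(\<Sum>l\<in>S. w l * norm (x l)) \<le> C" if "finite S" "S \<subseteq> \<Lambda>" for S
    using weighted_l1_norm_le_iff[of C \<Lambda> w x, OF C(1) w] C(2) that by simp
  have le_X: "(\<Sum>l\<in>S. w l * norm (X n l)) \<le> c n" if "finite S" "S \<subseteq> \<Lambda>" for S n
    using weighted_l1_norm_le_iff[of "c n" \<Lambda> w "X n", OF c(1) w] c(2) that by simp
  have "\<exists>S. finite S \<and> S \<subseteq> \<Lambda> \<and> (\<Sum>l\<in>S. w l * norm (x l)) > C - e / 3"
  proof (rule ccontr)
    assume neg: "\<not> ?thesis"
    have small: "(\<Sum>l\<in>S. w l * norm (x l)) \<le> C - e / 3" if "finite S" "S \<subseteq> \<Lambda>" for S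
      using neg that by (metis not_less)
    from this[of "{}"] have "C - e / 3 \<ge> 0" by simp
    then have "ennreal C \<le> ennreal (C - e / 3)"
      using weighted_l1_norm_le_iff[of "C - e / 3" \<Lambda> w x, OF _ w] small by (simp add: C(2))
    with C(1) \<open>e > 0\<close> \<open>C - e / 3 \<ge> 0\<close> show False by simp
  qed
  then obtain S where S: "finite S" "S \<subseteq> \<Lambda>" and big: "(\<Sum>l\<in>S. w l * norm (x l)) > C - e / 3"
    by blast
  define g where "g = (\<lambda>n. (\<Sum>l\<in>S. w l * norm (X n l - x l)) + (c n - (\<Sum>l\<in>S. w l * norm (X n l)))
    + (C - (\<Sum>l\<in>S. w l * norm (x l))))"
  have lim: "g \<longlonglongrightarrow> (\<Sum>l\<in>S. w l * norm (x l - x l)) + (C - (\<Sum>l\<in>S. w l * norm (x l)))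
    + (C - (\<Sum>l\<in>S. w l * norm (x l)))"
    unfolding g_def using coord S(2) c(3) by (intro tendsto_intros) auto
  have "\<forall>\<^sub>F n in sequentially. g n < e"
    by (rule order_tendstoD(2)[OF lim]) (use big \<open>e > 0\<close> in simp)
  then show ?thesis
  proof eventually_elim
    case (elim n)
    have "(\<Sum>l\<in>T. w l * norm (X n l - x l)) \<le> e" if T: "finite T" "T \<subseteq> \<Lambda>" for T
    proof -
      have split: "(\<Sum>l\<in>S \<union> T. f l) = (\<Sum>l\<in>S. f l) + (\<Sum>l\<in>T - S. f l)" for f :: "'l \<Rightarrow> real"
        using S(1) T(1) sum.union_disjoint[of S "T - S" f] by auto
      have ST: "finite (S \<union> T)" "S \<union> T \<subseteq> \<Lambda>" using S T by auto
      have "(\<Sum>l\<in>T. w l * norm (X n l - x l)) \<le> (\<Sum>l\<in>S \<union> T. w l * norm (X n l - x l))"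
        using ST w by (intro sum_mono2) (auto intro!: mult_nonneg_nonneg intro: less_imp_le)
      also have "\<dots> \<le> (\<Sum>l\<in>S. w l * norm (X n l - x l))
          + (\<Sum>l\<in>T - S. w l * norm (X n l) + w l * norm (x l))"
        unfolding split
      proof (intro add_left_mono sum_mono)
        fix l assume "l \<in> T - S"
        then have "w l \<ge> 0" using T(2) w by (auto intro: less_imp_le)
        then show "w l * norm (X n l - x l) \<le> w l * norm (X n l) + w l * norm (x l)"
          unfolding distrib_left[symmetric] by (intro mult_left_mono norm_triangle_ineq4)
      qed
      also have "\<dots> \<le> g n"
        using le_x[OF ST] le_X[OF ST, of n] unfolding g_def sum.distrib split by simp
      finally show ?thesis using elim by simp
    qed
    with \<open>e > 0\<close> show ?case
      by (subst weighted_l1_norm_le_iff[OF _ w]) auto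
  qed
qed

section \<open>Uniform approximation on balls\<close>

lemma norm_diff_le_approx_error:
  assumes "x \<in> ell2 \<Lambda>" "ell2_norm \<Lambda> x \<le> r"
  shows "ennreal (norm (Da a x - D x)) \<le> approx_error \<Lambda> D Da r a"
  unfolding approx_error_def using assms by (intro SUP_upper) auto

lemma approx_error_tendsto_bound:
  assumes "(approx_error \<Lambda> D Da r \<longlongrightarrow> 0) F" "e > 0"
  shows "\<forall>\<^sub>F a in F. \<forall>x\<in>ell2 \<Lambda>. ell2_norm \<Lambda> x \<le> r \<longrightarrow> norm (Da a x - D x) < e"
proof -
  have "\<forall>\<^sub>F a in F. approx_error \<Lambda> D Da r a < ennreal e"
    using assms by (intro order_tendstoD(2)) auto
  then show ?thesis
  proof eventually_elim
    case (elim a)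
    then show ?case
      using le_less_trans[OF norm_diff_le_approx_error] by (fastforce simp: ennreal_less_iff)
  qed
qed

text \<open>
  A uniform limit on balls of weakly sequentially continuous maps is weakly sequentially continuous
  along bounded sequences.
\<close>

lemma weak_limit_uniform_approx:
  assumes cont: "\<And>a. a > 0 \<Longrightarrow> weakly_seq_continuous \<Lambda> (Da a)"
    and approx: "(approx_error \<Lambda> D Da r \<longlongrightarrow> 0) (at_right 0)"
    and X: "ell2_weak_limit \<Lambda> X x" "\<And>n. ell2_norm \<Lambda> (X n) \<le> r" "ell2_norm \<Lambda> x \<le> r"
  shows "weak_limit (\<lambda>n. D (X n)) (D x)"
  unfolding weak_limit_def
proof (intro allI impI)
  fix f :: "'c \<Rightarrow> real" assume f: "bounded_linear f"
  then interpret f: bounded_linear f .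
  obtain B where B: "B > 0" "\<And>u. norm (f u) \<le> norm u * B"
    using f.pos_bounded by blast
  have mem: "X n \<in> ell2 \<Lambda>" "x \<in> ell2 \<Lambda>" for n
    using X(1) by (auto simp: ell2_weak_limit_def)
  show "(\<lambda>n. f (D (X n))) \<longlonglongrightarrow> f (D x)"
  proof (rule tendstoI)
    fix e :: real assume "e > 0"
    then have "\<forall>\<^sub>F a in at_right 0. \<forall>x\<in>ell2 \<Lambda>. ell2_norm \<Lambda> x \<le> r \<longrightarrow> norm (Da a x - D x) < e / (3 * B)"
      using B(1) by (intro approx_error_tendsto_bound approx) auto
    then have "\<forall>\<^sub>F a in at_right 0. 0 < a \<and>
        (\<forall>x\<in>ell2 \<Lambda>. ell2_norm \<Lambda> x \<le> r \<longrightarrow> norm (Da a x - D x) < e / (3 * B))"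
      using eventually_at_right_less[of 0] by eventually_elim auto
    then obtain a where a: "a > 0"
      and close: "\<And>x. x \<in> ell2 \<Lambda> \<Longrightarrow> ell2_norm \<Lambda> x \<le> r \<Longrightarrow> norm (Da a x - D x) < e / (3 * B)"
      using eventually_happens'[OF trivial_limit_at_right_real] by blast
    have fclose: "\<bar>f (Da a y) - f (D y)\<bar> < e / 3" if "y \<in> ell2 \<Lambda>" "ell2_norm \<Lambda> y \<le> r" for y
    proof -
      have "\<bar>f (Da a y) - f (D y)\<bar> \<le> norm (Da a y - D y) * B"
        using B(2)[of "Da a y - D y"] by (simp add: f.diff)
      also have "\<dots> < e / (3 * B) * B"
        using close[OF that] B(1) by (intro mult_strict_right_mono)
      finally show ?thesis using B(1) by simp
    qed
    have "(\<lambda>n. f (Da a (X n))) \<longlonglongrightarrow> f (Da a x)"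
      using cont[OF a] X(1) f by (auto simp: weakly_seq_continuous_def weak_limit_def)
    then have "\<forall>\<^sub>F n in sequentially. dist (f (Da a (X n))) (f (Da a x)) < e / 3"
      using \<open>e > 0\<close> by (intro tendstoD) auto
    then show "\<forall>\<^sub>F n in sequentially. dist (f (D (X n))) (f (D x)) < e"
    proof eventually_elim
      case (elim n)
      then show ?case
        using fclose[OF mem(1) X(2), of n] fclose[OF mem(2) X(3)] unfolding dist_real_def by linarith
    qed
  qed
qed

section \<open>Weak limits and subsequences\<close>

lemma weak_limit_bounded_linear:
  assumes "bounded_linear K" "weak_limit X x"
  shows "weak_limit (\<lambda>n. K (X n)) (K x)"
  using assms bounded_linear_compose[OF _ assms(1)] by (auto simp: weak_limit_def)

lemma weak_limit_unique_tendsto: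
  fixes x y :: "'a::real_inner"
  assumes "weak_limit X x" "X \<longlonglongrightarrow> y"
  shows "x = y"
proof -
  have "(\<lambda>n. X n \<bullet> (x - y)) \<longlonglongrightarrow> x \<bullet> (x - y)"
    using assms(1) bounded_linear_inner_left by (auto simp: weak_limit_def)
  moreover have "(\<lambda>n. X n \<bullet> (x - y)) \<longlonglongrightarrow> y \<bullet> (x - y)"
    by (intro tendsto_intros assms)
  ultimately have "(x - y) \<bullet> (x - y) = 0"
    using LIMSEQ_unique[of _ "x \<bullet> (x - y)" "y \<bullet> (x - y)"] by (simp add: inner_diff_left)
  then show ?thesis by simp
qed

lemma tendsto_subseqI:
  fixes f :: "nat \<Rightarrow> 'a::metric_space"
  assumes "\<And>s::nat \<Rightarrow> nat. strict_mono s \<Longrightarrow> \<exists>t::nat \<Rightarrow> nat. strict_mono t \<and> (f \<circ> s \<circ> t) \<longlonglongrightarrow> x"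
  shows "f \<longlonglongrightarrow> x"
proof (rule ccontr)
  assume "\<not> f \<longlonglongrightarrow> x"
  then obtain e where "e > 0" and "\<exists>\<^sub>F n in sequentially. dist (f n) x \<ge> e"
    by (auto simp: tendsto_iff not_eventually not_less)
  then have inf: "infinite {n. dist (f n) x \<ge> e}"
    by (simp add: INFM_iff_infinite flip: cofinite_eq_sequentially)
  define s where "s = enumerate {n. dist (f n) x \<ge> e}"
  have s: "strict_mono s" "\<And>n. dist (f (s n)) x \<ge> e"
    using inf enumerate_in_set[OF inf] by (auto simp: s_def strict_mono_enumerate)
  obtain t :: "nat \<Rightarrow> nat" where "(f \<circ> s \<circ> t) \<longlonglongrightarrow> x"
    using assms[OF s(1)] by blast
  then have "\<forall>\<^sub>F n in sequentially. dist (f (s (t n))) x < e"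
    using tendstoD[OF _ \<open>e > 0\<close>] by fastforce
  then obtain n where "dist (f (s (t n))) x < e"
    using eventually_happens'[OF sequentially_bot] by blast
  with s(2)[of "t n"] show False by simp
qed

section \<open>Minimizers of the synthesis functional\<close>

text \<open>Both bounds compare the value of the functional at the minimizer with its value at \<open>x0\<close>.\<close>

lemma synthesis_minimizer_bounds:
  fixes x x0 :: "'l \<Rightarrow> 'k::{real_normed_field, euclidean_space}"
  assumes min: "is_arg_min (synthesis_functional \<Lambda> w K Da a v) (\<lambda>\<eta>. \<eta> \<in> ell2 \<Lambda>) x"
    and x0: "x0 \<in> ell2 \<Lambda>" "weighted_l1_norm \<Lambda> w x0 = ennreal C" "C \<ge> 0" and "a > 0"
    and m: "m = norm (K (Da a x0) - v)"
  shows "x \<in> ell2 \<Lambda>"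
    and "(norm (K (Da a x) - v))\<^sup>2 \<le> m\<^sup>2 + a * C"
    and "weighted_l1_norm \<Lambda> w x \<le> ennreal (m\<^sup>2 / a + C)"
proof -
  show "x \<in> ell2 \<Lambda>" using min by (simp add: is_arg_min_def)
  have "synthesis_functional \<Lambda> w K Da a v x \<le> synthesis_functional \<Lambda> w K Da a v x0"
    using min x0(1) by (auto simp: is_arg_min_def not_less)
  also have "\<dots> = ennreal (m\<^sup>2 + a * C)"
    using x0(2,3) \<open>a > 0\<close> by (simp add: synthesis_functional_def m ennreal_mult ennreal_plus)
  finally have le: "ennreal ((norm (K (Da a x) - v))\<^sup>2) + ennreal a * weighted_l1_norm \<Lambda> w x \<le> ennreal (m\<^sup>2 + a * C)"
    by (simp add: synthesis_functional_def)
  have "ennreal ((norm (K (Da a x) - v))\<^sup>2) \<le> ennreal (m\<^sup>2 + a * C)"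
    using le by (rule order_trans[rotated]) simp
  then show "(norm (K (Da a x) - v))\<^sup>2 \<le> m\<^sup>2 + a * C"
    using x0(3) \<open>a > 0\<close> by (subst (asm) ennreal_le_iff) auto
  have "ennreal a * weighted_l1_norm \<Lambda> w x \<le> ennreal (m\<^sup>2 + a * C)"
    using le by (rule order_trans[rotated]) simp
  then have "ennreal (1 / a) * (ennreal a * weighted_l1_norm \<Lambda> w x) \<le> ennreal (1 / a) * ennreal (m\<^sup>2 + a * C)"
    by (rule mult_left_mono) simp
  moreover have "ennreal (1 / a) * (ennreal a * weighted_l1_norm \<Lambda> w x) = weighted_l1_norm \<Lambda> w x"
    using \<open>a > 0\<close> by (simp add: mult.assoc[symmetric] ennreal_mult'[symmetric])
  moreover have "ennreal (1 / a) * ennreal (m\<^sup>2 + a * C) = ennreal (m\<^sup>2 / a + C)"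
  proof -
    have "1 / a * (m\<^sup>2 + a * C) = m\<^sup>2 / a + C"
      using \<open>a > 0\<close> by (simp add: field_simps)
    then show ?thesis
      using ennreal_mult[of "1 / a" "m\<^sup>2 + a * C"] \<open>a > 0\<close> x0(3)
      by (metis add_nonneg_nonneg divide_nonneg_pos less_imp_le mult_nonneg_nonneg zero_le_one zero_le_power2)
  qed
  ultimately show "weighted_l1_norm \<Lambda> w x \<le> ennreal (m\<^sup>2 / a + C)" by simp
qed

text \<open>
  At an exact solution \<open>x0\<close> the residual is at most \<open>\<parallel>K\<parallel> * \<Delta>\<^sub>\<rho>(a k) + \<delta> k\<close>, so the
  parameter choice makes its square negligible against \<open>a k\<close>.
\<close>

lemma discrepancy_quotient_tendsto_0:
  fixes x0 :: "'l \<Rightarrow> 'k::{real_normed_field, euclidean_space}"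
  assumes K: "bounded_linear K" and x0: "x0 \<in> ell2 \<Lambda>" "ell2_norm \<Lambda> x0 \<le> \<rho>" "K (D x0) = v"
    and a: "\<And>k. a k > 0"
    and approx: "(\<lambda>k. (approx_error \<Lambda> D Da \<rho> (a k))\<^sup>2 / ennreal (a k)) \<longlonglongrightarrow> 0"
    and \<delta>: "(\<lambda>k. (\<delta> k)\<^sup>2 / a k) \<longlonglongrightarrow> 0" "\<And>k. norm (v - vs k) \<le> \<delta> k"
  shows "(\<lambda>k. (norm (K (Da (a k) x0) - vs k))\<^sup>2 / a k) \<longlonglongrightarrow> 0"
proof -
  define g where "g = (\<lambda>k. norm (Da (a k) x0 - D x0))"
  have "(\<lambda>k. ennreal ((g k)\<^sup>2 / a k)) \<longlonglongrightarrow> 0"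
  proof (rule tendsto_sandwich[OF _ _ tendsto_const approx])
    show "\<forall>\<^sub>F k in sequentially. ennreal ((g k)\<^sup>2 / a k) \<le> (approx_error \<Lambda> D Da \<rho> (a k))\<^sup>2 / ennreal (a k)"
    proof (intro always_eventually allI)
      fix k
      have "ennreal ((g k)\<^sup>2 / a k) = (ennreal (g k))\<^sup>2 / ennreal (a k)"
        using a[of k] by (simp add: g_def ennreal_power divide_ennreal)
      also have "\<dots> \<le> (approx_error \<Lambda> D Da \<rho> (a k))\<^sup>2 / ennreal (a k)"
        unfolding g_def
        by (intro divide_right_mono_ennreal power_mono norm_diff_le_approx_error x0) simp
      finally show "ennreal ((g k)\<^sup>2 / a k) \<le> (approx_error \<Lambda> D Da \<rho> (a k))\<^sup>2 / ennreal (a k)" .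
    qed
  qed simp
  then have g: "(\<lambda>k. (g k)\<^sup>2 / a k) \<longlonglongrightarrow> 0"
    using a by (subst (asm) tendsto_ennreal_iff[of _ _ 0, unfolded ennreal_0])
      (auto intro!: always_eventually divide_nonneg_pos)
  obtain B where B: "\<And>u. norm (K u) \<le> norm u * B"
    using bounded_linear.bounded[OF K] by blast
  have bound: "(norm (K (Da (a k) x0) - vs k))\<^sup>2 / a k \<le> 2 * B\<^sup>2 * ((g k)\<^sup>2 / a k) + 2 * ((\<delta> k)\<^sup>2 / a k)" for k
  proof -
    have "norm (K (Da (a k) x0) - vs k) = norm (K (Da (a k) x0 - D x0) + (v - vs k))"
      using x0(3) by (simp add: linear_diff[OF bounded_linear.linear[OF K]])
    also have "\<dots> \<le> g k * B + \<delta> k"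
      unfolding g_def using B \<delta>(2) by (intro norm_triangle_le add_mono)
    finally have "(norm (K (Da (a k) x0) - vs k))\<^sup>2 \<le> (g k * B + \<delta> k)\<^sup>2"
      by (intro power_mono) auto
    also have "\<dots> \<le> 2 * B\<^sup>2 * (g k)\<^sup>2 + 2 * (\<delta> k)\<^sup>2"
      using sum_squares_bound[of "g k * B" "\<delta> k"] by (simp add: power2_sum power_mult_distrib mult.commute)
    finally show ?thesis
      using a[of k] by (simp add: field_simps)
  qed
  have "(\<lambda>k. 2 * B\<^sup>2 * ((g k)\<^sup>2 / a k) + 2 * ((\<delta> k)\<^sup>2 / a k)) \<longlonglongrightarrow> 2 * B\<^sup>2 * 0 + 2 * 0"
    by (intro tendsto_intros g \<delta>)
  then have lim: "(\<lambda>k. 2 * B\<^sup>2 * ((g k)\<^sup>2 / a k) + 2 * ((\<delta> k)\<^sup>2 / a k)) \<longlonglongrightarrow> 0"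
    by simp
  show ?thesis
    by (rule tendsto_sandwich[OF _ _ tendsto_const lim])
      (use bound a in \<open>auto intro!: always_eventually divide_nonneg_pos\<close>)
qed

text \<open>
  Boundedness of the weighted \<open>\<ell>\<^sup>1\<close>-norms gives a subsequence that converges coordinatewise, hence
  weakly. Its limit \<open>\<eta>\<close> solves the equation and has weighted norm at most \<open>C\<close>, so it is \<open>x0\<close> by
  uniqueness. As the norms do not exceed \<open>C\<close> in the limit, no mass is lost and the convergence is
  strong.
\<close>

lemma strongly_convergent_subsequence:
  fixes X :: "nat \<Rightarrow> 'l \<Rightarrow> 'k::{real_normed_field, euclidean_space}"
    and K :: "'u::real_normed_vector \<Rightarrow> 'v::real_inner"
  assumes K: "bounded_linear K" and "countable \<Lambda>"
    and cont: "\<And>a. a > 0 \<Longrightarrow> weakly_seq_continuous \<Lambda> (Da a)"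
    and w: "w0 > 0" "\<And>l. l \<in> \<Lambda> \<Longrightarrow> w l \<ge> w0"
    and approx: "\<And>r. r > 0 \<Longrightarrow> (approx_error \<Lambda> D Da r \<longlongrightarrow> 0) (at_right 0)"
    and sol: "l1_minimizing_solution \<Lambda> w (K \<circ> D) v x0"
    and unique: "\<And>\<eta>. l1_minimizing_solution \<Lambda> w (K \<circ> D) v \<eta> \<Longrightarrow> \<eta> = x0"
    and C: "weighted_l1_norm \<Lambda> w x0 = ennreal C" "C \<ge> 0"
    and X: "\<And>n. X n \<in> ell2 \<Lambda>" "\<And>n. weighted_l1_norm \<Lambda> w (X n) \<le> ennreal (c n)" "\<And>n. c n \<ge> 0"
    and c: "c \<longlonglongrightarrow> C"
    and a: "filterlim a (at_right 0) sequentially"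
    and res: "(\<lambda>n. K (Da (a n) (X n))) \<longlonglongrightarrow> v"
  obtains t :: "nat \<Rightarrow> nat" where "strict_mono t"
    "(\<lambda>n. ell2_norm \<Lambda> (\<lambda>l. X (t n) l - x0 l)) \<longlonglongrightarrow> 0"
proof -
  have wpos: "\<And>l. l \<in> \<Lambda> \<Longrightarrow> w l > 0" using w by force
  have x0: "x0 \<in> ell2 \<Lambda>" using sol by (simp add: l1_minimizing_solution_def is_arg_min_def)
  obtain b where b: "\<And>n. \<bar>c n\<bar> \<le> b"
    using convergent_imp_Bseq[of c] c by (auto simp: Bseq_def convergent_def)
  \<comment> \<open>a common \<open>\<ell>\<^sup>2\<close>-bound for the sequence and for its limit; the summand 1 makes it positive\<close>
  define r where "r = (b + C + 1) / w0"
  have "b \<ge> 0" using b[of 0] by linarith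
  then have "r > 0" using C(2) w(1) by (simp add: r_def)
  have Xr: "ell2_norm \<Lambda> (X n) \<le> r" for n
  proof -
    have "ell2_norm \<Lambda> (X n) \<le> c n / w0"
      by (rule ell2_norm_le_weighted_l1_norm(2)[OF w X(3) ell2_eq_0[OF X(1)] X(2)])
    also have "\<dots> \<le> r" unfolding r_def using b[of n] C(2) w(1) by (intro divide_right_mono) auto
    finally show ?thesis .
  qed
  have "norm (X n l) \<le> r" if "l \<in> \<Lambda>" for n l
    using ell2_sum_le[OF X(1) Xr, of "{l}" n] that \<open>r > 0\<close> by (simp add: power2_le_iff_abs_le)
  then obtain t :: "nat \<Rightarrow> nat" where t: "strict_mono t"
    and "\<And>l. l \<in> \<Lambda> \<Longrightarrow> \<exists>z. (\<lambda>n. X (t n) l) \<longlonglongrightarrow> z"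
    using function_convergent_subsequence[OF \<open>countable \<Lambda>\<close>, of X r] by blast
  then obtain y where y: "\<And>l. l \<in> \<Lambda> \<Longrightarrow> (\<lambda>n. X (t n) l) \<longlonglongrightarrow> y l"
    by metis
  define \<eta> where "\<eta> = (\<lambda>l. if l \<in> \<Lambda> then y l else 0)"
  have coord: "(\<lambda>n. X (t n) l) \<longlonglongrightarrow> \<eta> l" if "l \<in> \<Lambda>" for l
    using y[OF that] that by (simp add: \<eta>_def)
  have ct: "(\<lambda>n. c (t n)) \<longlonglongrightarrow> C"
    using LIMSEQ_subseq_LIMSEQ[OF c t] by (simp add: o_def)
  have \<eta>C: "weighted_l1_norm \<Lambda> w \<eta> \<le> ennreal C"
    by (rule weighted_l1_norm_lower_semicontinuous[OF wpos coord X(3) X(2) ct])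
  have \<eta>: "\<eta> \<in> ell2 \<Lambda>" "ell2_norm \<Lambda> \<eta> \<le> C / w0"
    by (rule ell2_norm_le_weighted_l1_norm[OF w C(2) _ \<eta>C]; simp add: \<eta>_def)+
  have \<eta>r: "ell2_norm \<Lambda> \<eta> \<le> r"
    using \<eta>(2) \<open>b \<ge> 0\<close> w(1) by (auto simp: r_def divide_right_mono intro: order_trans)
  have wlim: "ell2_weak_limit \<Lambda> (\<lambda>n. X (t n)) \<eta>"
    by (rule ell2_weak_limitI[OF X(1) Xr \<eta>(1) coord])
  have "weak_limit (\<lambda>n. D (X (t n))) (D \<eta>)"
    by (rule weak_limit_uniform_approx[OF cont approx[OF \<open>r > 0\<close>] wlim Xr \<eta>r])
  then have weak: "weak_limit (\<lambda>n. K (D (X (t n)))) (K (D \<eta>))"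
    by (rule weak_limit_bounded_linear[OF K])
  have "(\<lambda>n. Da (a n) (X n) - D (X n)) \<longlonglongrightarrow> 0"
  proof (rule tendstoI)
    fix e :: real assume "e > 0"
    have "\<forall>\<^sub>F n in sequentially. \<forall>x\<in>ell2 \<Lambda>. ell2_norm \<Lambda> x \<le> r \<longrightarrow> norm (Da (a n) x - D x) < e"
      by (rule eventually_compose_filterlim[OF approx_error_tendsto_bound[OF approx[OF \<open>r > 0\<close>] \<open>e > 0\<close>] a])
    then show "\<forall>\<^sub>F n in sequentially. dist (Da (a n) (X n) - D (X n)) 0 < e"
      by eventually_elim (use X(1) Xr in simp)
  qed
  then have "(\<lambda>n. K (Da (a n) (X n)) - K (Da (a n) (X n) - D (X n))) \<longlonglongrightarrow> v - K 0"
    by (intro tendsto_diff res bounded_linear.tendsto[OF K])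
  then have "(\<lambda>n. K (D (X n))) \<longlonglongrightarrow> v"
    by (simp add: linear_diff[OF bounded_linear.linear[OF K]] linear_0[OF bounded_linear.linear[OF K]])
  from LIMSEQ_subseq_LIMSEQ[OF this t] have "(\<lambda>n. K (D (X (t n)))) \<longlonglongrightarrow> v"
    by (simp add: o_def)
  with weak have "K (D \<eta>) = v"
    by (rule weak_limit_unique_tendsto)
  have "l1_minimizing_solution \<Lambda> w (K \<circ> D) v \<eta>"
    unfolding l1_minimizing_solution_def is_arg_min_def
  proof (intro conjI notI)
    assume "\<exists>z. (z \<in> ell2 \<Lambda> \<and> (K \<circ> D) z = v) \<and> weighted_l1_norm \<Lambda> w z < weighted_l1_norm \<Lambda> w \<eta>"
    then obtain z where "z \<in> ell2 \<Lambda>" "(K \<circ> D) z = v" "weighted_l1_norm \<Lambda> w z < weighted_l1_norm \<Lambda> w x0"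
      using \<eta>C C(1) by (metis less_le_trans)
    with sol show False by (auto simp: l1_minimizing_solution_def is_arg_min_def)
  qed (use \<eta> \<eta>C \<open>K (D \<eta>) = v\<close> in \<open>auto intro: le_less_trans\<close>)
  then have "\<eta> = x0" by (rule unique)
  have "(\<lambda>n. ell2_norm \<Lambda> (\<lambda>l. X (t n) l - x0 l)) \<longlonglongrightarrow> 0"
  proof (rule tendstoI)
    fix e :: real assume "e > 0"
    define e' where "e' = e / 2 * w0"
    have "e' > 0" using \<open>e > 0\<close> w(1) by (simp add: e'_def)
    have "\<forall>\<^sub>F n in sequentially. weighted_l1_norm \<Lambda> w (\<lambda>l. X (t n) l - x0 l) \<le> ennreal e'"
      by (rule weighted_l1_norm_diff_le[OF wpos coord[unfolded \<open>\<eta> = x0\<close>] X(3) X(2) ct C(2) C(1) \<open>e' > 0\<close>])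
    then show "\<forall>\<^sub>F n in sequentially. dist (ell2_norm \<Lambda> (\<lambda>l. X (t n) l - x0 l)) 0 < e"
    proof eventually_elim
      case (elim n)
      have "ell2_norm \<Lambda> (\<lambda>l. X (t n) l - x0 l) \<le> e' / w0"
        using \<open>e' > 0\<close> ell2_eq_0[OF X(1)] ell2_eq_0[OF x0]
        by (intro ell2_norm_le_weighted_l1_norm(2)[OF w _ _ elim]) auto
      also have "\<dots> < e" using \<open>e > 0\<close> w(1) by (simp add: e'_def)
      finally show ?case by (simp add: ell2_norm_nonneg)
    qed
  qed
  with t that show thesis by blast
qed

theorem theorem2p5:
  fixes K :: "'u::{real_inner, banach} \<Rightarrow> 'v::{real_inner, banach}"
    and \<Lambda> :: "'l set"
    and D :: "('l \<Rightarrow> 'k::{real_normed_field, euclidean_space}) \<Rightarrow> 'u"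
    and Da :: "real \<Rightarrow> ('l \<Rightarrow> 'k) \<Rightarrow> 'u"
    and w :: "'l \<Rightarrow> real"
    and v :: 'v
    and \<xi>\<^sub>0 :: "'l \<Rightarrow> 'k"
    and \<rho> :: real
    and \<alpha> :: "real \<Rightarrow> real"
    and \<delta> :: "nat \<Rightarrow> real"
    and v_seq :: "nat \<Rightarrow> 'v"
    and \<xi> :: "nat \<Rightarrow> 'l \<Rightarrow> 'k"
  assumes "bounded_linear K"
    and "countable \<Lambda>"
    and "\<And>a. a > 0 \<Longrightarrow> weakly_seq_continuous \<Lambda> (Da a)"
    and "\<And>l. l \<in> \<Lambda> \<Longrightarrow> w l > 0"
    and "(INF l\<in>\<Lambda>. ennreal (w l)) > 0"
    and "\<And>r. r > 0 \<Longrightarrow> ((\<lambda>a. approx_error \<Lambda> D Da r a) \<longlongrightarrow> 0) (at_right 0)"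
    and "l1_minimizing_solution \<Lambda> w (K \<circ> D) v \<xi>\<^sub>0"
    and "\<And>\<eta>. l1_minimizing_solution \<Lambda> w (K \<circ> D) v \<eta> \<Longrightarrow> \<eta> = \<xi>\<^sub>0"
    and "\<rho> > ell2_norm \<Lambda> \<xi>\<^sub>0"
    and "\<And>d. d > 0 \<Longrightarrow> \<alpha> d > 0"
    and "(\<alpha> \<longlongrightarrow> 0) (at_right 0)"
    and "((\<lambda>d. (approx_error \<Lambda> D Da \<rho> (\<alpha> d))\<^sup>2 / ennreal (\<alpha> d)) \<longlongrightarrow> 0) (at_right 0)"
    and "((\<lambda>d. d\<^sup>2 / \<alpha> d) \<longlongrightarrow> 0) (at_right 0)"
    and "\<And>k. \<delta> k > 0"
    and "\<delta> \<longlonglongrightarrow> 0"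
    and "\<And>k. norm (v - v_seq k) \<le> \<delta> k"
    and "uniformly_Lipschitz \<Lambda> Da"
    and "\<And>k. is_arg_min (synthesis_functional \<Lambda> w K Da (\<alpha> (\<delta> k)) (v_seq k))
               (\<lambda>\<eta>. \<eta> \<in> ell2 \<Lambda>) (\<xi> k)"
  shows "(\<lambda>k. norm (Da (\<alpha> (\<delta> k)) (\<xi> k) - D \<xi>\<^sub>0)) \<longlonglongrightarrow> 0"
proof -
  note K = assms(1) and approx = assms(6) and sol = assms(7) and \<alpha>pos = assms(10)
    and \<delta>pos = assms(14) and min = assms(18)
  obtain w0 where w0: "w0 > 0" "\<And>l. l \<in> \<Lambda> \<Longrightarrow> w l \<ge> w0"
  proof -
    obtain z where z: "0 < z" "z < (INF l\<in>\<Lambda>. ennreal (w l))"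
      using dense[OF assms(5)] by blast
    then obtain w0 where "z = ennreal w0" "w0 \<ge> 0"
      by (cases z) auto
    moreover have "w0 \<le> w l" if "l \<in> \<Lambda>" for l
    proof -
      have "ennreal w0 < ennreal (w l)"
        using less_INF_D[OF z(2) that] \<open>z = ennreal w0\<close> by simp
      then show ?thesis using \<open>w0 \<ge> 0\<close> by (simp add: ennreal_less_iff)
    qed
    ultimately show thesis using z(1) that by auto
  qed
  have x0: "\<xi>\<^sub>0 \<in> ell2 \<Lambda>" "K (D \<xi>\<^sub>0) = v" "weighted_l1_norm \<Lambda> w \<xi>\<^sub>0 < \<infinity>"
    using sol by (auto simp: l1_minimizing_solution_def is_arg_min_def)
  then obtain C where C: "weighted_l1_norm \<Lambda> w \<xi>\<^sub>0 = ennreal C" "C \<ge> 0"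
    by (cases "weighted_l1_norm \<Lambda> w \<xi>\<^sub>0") auto
  have \<rho>: "ell2_norm \<Lambda> \<xi>\<^sub>0 \<le> \<rho>" "\<rho> > 0"
    using assms(9) ell2_norm_nonneg[of \<Lambda> \<xi>\<^sub>0] by linarith+
  define a where "a = (\<lambda>k. \<alpha> (\<delta> k))"
  have apos: "a k > 0" for k using \<alpha>pos \<delta>pos by (simp add: a_def)
  have \<delta>lim: "filterlim \<delta> (at_right 0) sequentially"
    using assms(15) \<delta>pos by (auto simp: filterlim_at intro!: always_eventually less_imp_neq[symmetric])
  have a0: "a \<longlonglongrightarrow> 0"
    unfolding a_def by (rule filterlim_compose[OF assms(11) \<delta>lim])
  have alim: "filterlim a (at_right 0) sequentially"
    using a0 apos by (auto simp: filterlim_at intro!: always_eventually less_imp_neq[symmetric])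
  define m where "m = (\<lambda>k. norm (K (Da (a k) \<xi>\<^sub>0) - v_seq k))"
  define c where "c = (\<lambda>k. (m k)\<^sup>2 / a k + C)"
  have m_a: "(\<lambda>k. (m k)\<^sup>2 / a k) \<longlonglongrightarrow> 0"
    unfolding m_def
  proof (rule discrepancy_quotient_tendsto_0[where K = K and D = D and a = a
        and \<delta> = \<delta> and vs = v_seq, OF K x0(1) \<rho>(1) x0(2) apos _ _ assms(16)])
    show "(\<lambda>k. (approx_error \<Lambda> D Da \<rho> (a k))\<^sup>2 / ennreal (a k)) \<longlonglongrightarrow> 0"
      unfolding a_def by (rule filterlim_compose[OF assms(12) \<delta>lim])
    show "(\<lambda>k. (\<delta> k)\<^sup>2 / a k) \<longlonglongrightarrow> 0"
      unfolding a_def by (rule filterlim_compose[OF assms(13) \<delta>lim])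
  qed
  have c: "c \<longlonglongrightarrow> C" "\<And>k. c k \<ge> 0"
    using tendsto_add[OF m_a tendsto_const, of C] apos C(2)
    by (auto simp: c_def intro!: add_nonneg_nonneg divide_nonneg_pos)
  have min_a: "is_arg_min (synthesis_functional \<Lambda> w K Da (a k) (v_seq k)) (\<lambda>\<eta>. \<eta> \<in> ell2 \<Lambda>) (\<xi> k)" for k
    using min by (simp add: a_def)
  have bounds: "\<xi> k \<in> ell2 \<Lambda>" "(norm (K (Da (a k) (\<xi> k)) - v_seq k))\<^sup>2 \<le> (m k)\<^sup>2 + a k * C"
    "weighted_l1_norm \<Lambda> w (\<xi> k) \<le> ennreal (c k)" for k
    using synthesis_minimizer_bounds[OF min_a x0(1) C apos m_def[THEN fun_cong]]
    by (simp_all add: c_def)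
  have res: "(\<lambda>k. K (Da (a k) (\<xi> k))) \<longlonglongrightarrow> v"
  proof -
    have "(\<lambda>k. a k * ((m k)\<^sup>2 / a k) + a k * C) \<longlonglongrightarrow> 0 * 0 + 0 * C"
      by (intro tendsto_intros a0 m_a)
    moreover have "a k * ((m k)\<^sup>2 / a k) = (m k)\<^sup>2" for k
      using apos[of k] by simp
    ultimately have lim: "(\<lambda>k. (m k)\<^sup>2 + a k * C) \<longlonglongrightarrow> 0"
      by simp
    have "(\<lambda>k. (norm (K (Da (a k) (\<xi> k)) - v_seq k))\<^sup>2) \<longlonglongrightarrow> 0"
      by (rule tendsto_sandwich[OF _ _ tendsto_const lim]) (use bounds(2) in auto)
    then have "(\<lambda>k. sqrt ((norm (K (Da (a k) (\<xi> k)) - v_seq k))\<^sup>2)) \<longlonglongrightarrow> sqrt 0"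
      by (rule tendsto_real_sqrt)
    then have "(\<lambda>k. K (Da (a k) (\<xi> k)) - v_seq k) \<longlonglongrightarrow> 0"
      by (simp add: tendsto_norm_zero_iff)
    moreover have "(\<lambda>k. v - v_seq k) \<longlonglongrightarrow> 0"
      by (rule Lim_null_comparison[OF _ assms(15)]) (use assms(16) in auto)
    ultimately have "(\<lambda>k. (K (Da (a k) (\<xi> k)) - v_seq k) - (v - v_seq k) + v) \<longlonglongrightarrow> 0 - 0 + v"
      by (intro tendsto_intros)
    then show ?thesis by simp
  qed
  have strong: "(\<lambda>k. ell2_norm \<Lambda> (\<lambda>l. \<xi> k l - \<xi>\<^sub>0 l)) \<longlonglongrightarrow> 0"
  proof (rule tendsto_subseqI)
    fix s :: "nat \<Rightarrow> nat" assume s: "strict_mono s"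
    have cs: "(\<lambda>n. c (s n)) \<longlonglongrightarrow> C" and ress: "(\<lambda>n. K (Da (a (s n)) (\<xi> (s n)))) \<longlonglongrightarrow> v"
      using LIMSEQ_subseq_LIMSEQ[OF c(1) s] LIMSEQ_subseq_LIMSEQ[OF res s] by (simp_all add: o_def)
    have as: "filterlim (\<lambda>n. a (s n)) (at_right 0) sequentially"
      by (rule filterlim_compose[OF alim filterlim_subseq[OF s]])
    obtain t :: "nat \<Rightarrow> nat" where "strict_mono t"
      "(\<lambda>n. ell2_norm \<Lambda> (\<lambda>l. \<xi> (s (t n)) l - \<xi>\<^sub>0 l)) \<longlonglongrightarrow> 0"
      by (rule strongly_convergent_subsequence[OF K assms(2,3) w0 approx sol assms(8) C
            bounds(1) bounds(3) c(2) cs as ress])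
    then show "\<exists>t. strict_mono t \<and>
        ((\<lambda>k. ell2_norm \<Lambda> (\<lambda>l. \<xi> k l - \<xi>\<^sub>0 l)) \<circ> s \<circ> t) \<longlonglongrightarrow> 0"
      by (auto simp: o_def)
  qed
  obtain L where L: "\<And>a \<xi> \<eta>. a > 0 \<Longrightarrow> \<xi> \<in> ell2 \<Lambda> \<Longrightarrow> \<eta> \<in> ell2 \<Lambda> \<Longrightarrow>
      norm (Da a \<xi> - Da a \<eta>) \<le> L * ell2_norm \<Lambda> (\<lambda>l. \<xi> l - \<eta> l)"
    using assms(17) unfolding uniformly_Lipschitz_def by blast
  have Da0: "(\<lambda>k. norm (Da (a k) \<xi>\<^sub>0 - D \<xi>\<^sub>0)) \<longlonglongrightarrow> 0"
  proof (rule tendstoI)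
    fix e :: real assume "e > 0"
    have "\<forall>\<^sub>F k in sequentially. \<forall>x\<in>ell2 \<Lambda>. ell2_norm \<Lambda> x \<le> \<rho> \<longrightarrow> norm (Da (a k) x - D x) < e"
      by (rule eventually_compose_filterlim[OF approx_error_tendsto_bound[OF approx[OF \<rho>(2)] \<open>e > 0\<close>] alim])
    then show "\<forall>\<^sub>F k in sequentially. dist (norm (Da (a k) \<xi>\<^sub>0 - D \<xi>\<^sub>0)) 0 < e"
      by eventually_elim (use x0(1) \<rho>(1) in simp)
  qed
  have lim: "(\<lambda>k. L * ell2_norm \<Lambda> (\<lambda>l. \<xi> k l - \<xi>\<^sub>0 l) + norm (Da (a k) \<xi>\<^sub>0 - D \<xi>\<^sub>0)) \<longlonglongrightarrow> L * 0 + 0"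
    by (intro tendsto_intros strong Da0)
  have "norm (Da (a k) (\<xi> k) - D \<xi>\<^sub>0)
      \<le> L * ell2_norm \<Lambda> (\<lambda>l. \<xi> k l - \<xi>\<^sub>0 l) + norm (Da (a k) \<xi>\<^sub>0 - D \<xi>\<^sub>0)" for k
    using norm_triangle_ineq[of "Da (a k) (\<xi> k) - Da (a k) \<xi>\<^sub>0" "Da (a k) \<xi>\<^sub>0 - D \<xi>\<^sub>0"]
      L[OF apos bounds(1) x0(1), of k k] by simp
  then have le: "norm (Da (\<alpha> (\<delta> k)) (\<xi> k) - D \<xi>\<^sub>0)
      \<le> L * ell2_norm \<Lambda> (\<lambda>l. \<xi> k l - \<xi>\<^sub>0 l) + norm (Da (a k) \<xi>\<^sub>0 - D \<xi>\<^sub>0)" for k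
    by (simp add: a_def)
  show ?thesis
    by (rule tendsto_sandwich[OF _ _ tendsto_const lim[simplified]]) (use le in auto)
qed

end
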